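(* Let $R$ be an integral domain, $\mathfrak G$ the matroid of a hyperplane arrangement on $[n]$, and $(\lambda,\eta)$ a resonant pair over $R$ with graph $\Gamma=\Gamma_{(\lambda,\eta)}$. Then (i) $\operatorname{supp}(\lambda,\eta)$ coincides with the set of non-cone vertices of $\Gamma$, and (ii) $\Gamma$ is transitive on $\operatorname{supp}(\lambda,\eta)$: whenever $i,j,k\in\operatorname{supp}(\lambda,\eta)$ with $\{i,j\},\{j,k\}$ edges of $\Gamma$ and $i\neq k$, $\{i,k\}$ is an edge of $\Gamma$.
   Context: Let $\mathcal A=\{H_1,\dots,H_n\}$ be an arrangement of distinct linear hyperplanes in $\mathbb C^\ell$ and $\mathfrak G$ its matroid on $[n]$: circuits are the minimal $C\subseteq[n]$ with $\operatorname{codim}\bigcap_{i\in C}H_i<|C|$. The Orlik–Solomon algebra $A_R(\mathfrak G)$ is the quotient of the exterior algebra over $R$ on $e_1,\dots,e_n$ by the ideal generated by $\partial e_C=\sum_{k=1}^p(-1)^{k-1}e_{i_1}\wedge\cdots\widehat{e_{i_k}}\cdots\wedge e_{i_p}$ for circuits $C=\{i_1<\dots<i_p\}$; $a_i$ is the image of $e_i$, $a_\xi=\sum_i\xi_ia_i$. $\lambda,\eta\in R^n$ are parallel if all $\lambda_i\eta_j-\lambda_j\eta_i=0$. A resonant pair is $(\lambda,\eta)$ with $a_\lambda\wedge a_\eta=0$ and $\eta$ not parallel to $\lambda$. $\operatorname{supp}(\lambda,\eta)=\{i:\lambda_i\ne0\text{ or }\eta_i\ne0\}$. $\Gamma_{(\lambda,\eta)}$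 is the graph on vertex set $[n]$ in which $\{i,j\}$ ($i\ne j$) is an edge iff $\lambda_i\eta_j-\lambda_j\eta_i=0$. A cone vertex is a vertex adjacent to every other vertex. *)

theory Defs
  imports "HOL-Analysis.Analysis" "HOL-Algebra.QuotRing" "HOL-Algebra.Module"
begin

section \<open>Hyperplane arrangements and their circuits\<close>

text \<open>The ambient space $\mathbf{C}^\ell$ is the type \<^typ>\<open>complex ^ 'l\<close>. The prefix
  \<open>vec.\<close> refers to its linear algebra over the complex field (with scalar multiplication
  \<open>(*s)\<close>); the unprefixed \<open>subspace\<close> and \<open>dim\<close> would be the real notions.\<close>

definition linear_hyperplane :: "(complex ^ 'l) set \<Rightarrow> bool" where
  "linear_hyperplane K \<longleftrightarrow> vec.subspace K \<and> vec.dim K + 1 = CARD('l)"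

definition hyperplane_arrangement :: "nat \<Rightarrow> (nat \<Rightarrow> (complex ^ 'l) set) \<Rightarrow> bool" where
  "hyperplane_arrangement n H \<longleftrightarrow>
     (\<forall>i\<in>{1..n}. linear_hyperplane (H i)) \<and> inj_on H {1..n}"

definition codim :: "(complex ^ 'l) set \<Rightarrow> nat" where
  "codim X = CARD('l) - vec.dim X"

definition dependent_set :: "(nat \<Rightarrow> (complex ^ 'l) set) \<Rightarrow> nat set \<Rightarrow> bool" where
  "dependent_set H C \<longleftrightarrow> codim (\<Inter>i\<in>C. H i) < card C"

text \<open>The matroid of an arrangement is represented by its set of circuits.\<close>

definition circuits :: "nat \<Rightarrow> (nat \<Rightarrow> (complex ^ 'l) set) \<Rightarrow> nat set set" where
  "circuits n H =
     {C. C \<subseteq> {1..n} \<and> dependent_set H C \<and> (\<forall>D. D \<subset> C \<longrightarrow> \<not> dependent_set H D)}"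


section \<open>The exterior algebra\<close>

text \<open>An element of the exterior algebra over \<open>R\<close> on $e_1,\dots,e_n$ is given by its
  coordinates in the monomial basis: the value at \<open>S = {i\<^sub>1 < \<dots> < i\<^sub>q}\<close> is the coefficient of
  $e_{i_1}\wedge\dots\wedge e_{i_q}$. For disjoint \<open>S\<close> and \<open>T\<close>, sorting the concatenation of
  the two increasing index sequences takes one transposition per pair
  \<open>(i, j) \<in> S \<times> T\<close> with \<open>j < i\<close>, whence the sign.\<close>

definition shuffle_sign :: "('a, 'm) ring_scheme \<Rightarrow> nat set \<Rightarrow> nat set \<Rightarrow> 'a" where
  "shuffle_sign R S T = (\<ominus>\<^bsub>R\<^esub> \<one>\<^bsub>R\<^esub>) [^]\<^bsub>R\<^esub> card {(i, j). i \<in> S \<and> j \<in> T \<and> j < i}"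

definition exterior_algebra ::
    "('a, 'm) ring_scheme \<Rightarrow> nat \<Rightarrow> ('a, nat set \<Rightarrow> 'a) module" where
  "exterior_algebra R n =
    \<lparr>carrier = Pow {1..n} \<rightarrow>\<^sub>E carrier R,
     mult = (\<lambda>x y. \<lambda>U\<in>Pow {1..n}.
       \<Oplus>\<^bsub>R\<^esub>S\<in>Pow U. shuffle_sign R S (U - S) \<otimes>\<^bsub>R\<^esub> (x S \<otimes>\<^bsub>R\<^esub> y (U - S))),
     one = (\<lambda>U\<in>Pow {1..n}. if U = {} then \<one>\<^bsub>R\<^esub> else \<zero>\<^bsub>R\<^esub>),
     zero = (\<lambda>U\<in>Pow {1..n}. \<zero>\<^bsub>R\<^esub>),
     add = (\<lambda>x y. \<lambda>U\<in>Pow {1..n}. x U \<oplus>\<^bsub>R\<^esub> y U),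
     smult = (\<lambda>r x. \<lambda>U\<in>Pow {1..n}. r \<otimes>\<^bsub>R\<^esub> x U)\<rparr>"

definition ext_monom :: "('a, 'm) ring_scheme \<Rightarrow> nat \<Rightarrow> nat set \<Rightarrow> (nat set \<Rightarrow> 'a)" where
  "ext_monom R n S = (\<lambda>U\<in>Pow {1..n}. if U = S then \<one>\<^bsub>R\<^esub> else \<zero>\<^bsub>R\<^esub>)"

definition ext_gen :: "('a, 'm) ring_scheme \<Rightarrow> nat \<Rightarrow> nat \<Rightarrow> (nat set \<Rightarrow> 'a)" where
  "ext_gen R n i = ext_monom R n {i}"

definition ext_wedge :: "('a, 'm) ring_scheme \<Rightarrow> nat \<Rightarrow> nat list \<Rightarrow> (nat set \<Rightarrow> 'a)" where
  "ext_wedge R n is =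
     foldr (\<lambda>i x. ext_gen R n i \<otimes>\<^bsub>exterior_algebra R n\<^esub> x) is \<one>\<^bsub>exterior_algebra R n\<^esub>"

text \<open>The positions \<open>k\<close> count from 0, so the sign $(-1)^{k-1}$ of the usual formula becomes
  $(-1)^k$.\<close>

definition ext_boundary :: "('a, 'm) ring_scheme \<Rightarrow> nat \<Rightarrow> nat set \<Rightarrow> (nat set \<Rightarrow> 'a)" where
  "ext_boundary R n C =
     (let is = sorted_list_of_set C in
      \<Oplus>\<^bsub>exterior_algebra R n\<^esub>k\<in>{..<length is}.
        ((\<ominus>\<^bsub>R\<^esub> \<one>\<^bsub>R\<^esub>) [^]\<^bsub>R\<^esub> k) \<odot>\<^bsub>exterior_algebra R n\<^esub>
          ext_wedge R n (take k is @ drop (Suc k) is))"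


section \<open>The Orlik--Solomon algebra and resonant pairs\<close>

definition os_ideal :: "('a, 'm) ring_scheme \<Rightarrow> nat \<Rightarrow> nat set set \<Rightarrow> (nat set \<Rightarrow> 'a) set" where
  "os_ideal R n \<C> = genideal (exterior_algebra R n) (ext_boundary R n ` \<C>)"

text \<open>The library's quotient ring carries no scalar multiplication; the one induced from the
  exterior algebra is added here, in the style of \<^const>\<open>rcoset_mult\<close>.\<close>

definition os_algebra ::
    "('a, 'm) ring_scheme \<Rightarrow> nat \<Rightarrow> nat set set \<Rightarrow> ('a, (nat set \<Rightarrow> 'a) set) module" where
  "os_algebra R n \<C> =
     ring.extend (exterior_algebra R n Quot os_ideal R n \<C>)
       \<lparr>smult = (\<lambda>r X. \<Union>x\<in>X.
          os_ideal R n \<C> +>\<^bsub>exterior_algebra R n\<^esub> (r \<odot>\<^bsub>exterior_algebra R n\<^esub> x))\<rparr>"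

definition os_gen ::
    "('a, 'm) ring_scheme \<Rightarrow> nat \<Rightarrow> nat set set \<Rightarrow> nat \<Rightarrow> (nat set \<Rightarrow> 'a) set" where
  "os_gen R n \<C> i = os_ideal R n \<C> +>\<^bsub>exterior_algebra R n\<^esub> ext_gen R n i"

definition os_linear ::
    "('a, 'm) ring_scheme \<Rightarrow> nat \<Rightarrow> nat set set \<Rightarrow> (nat \<Rightarrow> 'a) \<Rightarrow> (nat set \<Rightarrow> 'a) set" where
  "os_linear R n \<C> \<xi> =
     (\<Oplus>\<^bsub>os_algebra R n \<C>\<^esub>i\<in>{1..n}. \<xi> i \<odot>\<^bsub>os_algebra R n \<C>\<^esub> os_gen R n \<C> i)"

definition minor2 :: "('a, 'm) ring_scheme \<Rightarrow> (nat \<Rightarrow> 'a) \<Rightarrow> (nat \<Rightarrow> 'a) \<Rightarrow> nat \<Rightarrow> nat \<Rightarrow> 'a" where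
  "minor2 R lam eta i j = lam i \<otimes>\<^bsub>R\<^esub> eta j \<ominus>\<^bsub>R\<^esub> lam j \<otimes>\<^bsub>R\<^esub> eta i"

definition parallel :: "('a, 'm) ring_scheme \<Rightarrow> nat \<Rightarrow> (nat \<Rightarrow> 'a) \<Rightarrow> (nat \<Rightarrow> 'a) \<Rightarrow> bool" where
  "parallel R n lam eta \<longleftrightarrow> (\<forall>i\<in>{1..n}. \<forall>j\<in>{1..n}. minor2 R lam eta i j = \<zero>\<^bsub>R\<^esub>)"

definition resonant_pair ::
    "('a, 'm) ring_scheme \<Rightarrow> nat \<Rightarrow> nat set set \<Rightarrow> (nat \<Rightarrow> 'a) \<Rightarrow> (nat \<Rightarrow> 'a) \<Rightarrow> bool" where
  "resonant_pair R n \<C> lam eta \<longleftrightarrow>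
     lam \<in> {1..n} \<rightarrow> carrier R \<and> eta \<in> {1..n} \<rightarrow> carrier R \<and>
     os_linear R n \<C> lam \<otimes>\<^bsub>os_algebra R n \<C>\<^esub> os_linear R n \<C> eta = \<zero>\<^bsub>os_algebra R n \<C>\<^esub> \<and>
     \<not> parallel R n lam eta"

definition pair_support ::
    "('a, 'm) ring_scheme \<Rightarrow> nat \<Rightarrow> (nat \<Rightarrow> 'a) \<Rightarrow> (nat \<Rightarrow> 'a) \<Rightarrow> nat set" where
  "pair_support R n lam eta = {i\<in>{1..n}. lam i \<noteq> \<zero>\<^bsub>R\<^esub> \<or> eta i \<noteq> \<zero>\<^bsub>R\<^esub>}"


section \<open>The graph of a pair\<close>

text \<open>A simple graph is a pair of a vertex set and a set of two-element edges.\<close>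

type_synonym 'v graph = "'v set \<times> 'v set set"

definition cone_vertex :: "'v graph \<Rightarrow> 'v \<Rightarrow> bool" where
  "cone_vertex G v \<longleftrightarrow> v \<in> fst G \<and> (\<forall>w\<in>fst G. w \<noteq> v \<longrightarrow> {v, w} \<in> snd G)"

definition pair_graph ::
    "('a, 'm) ring_scheme \<Rightarrow> nat \<Rightarrow> (nat \<Rightarrow> 'a) \<Rightarrow> (nat \<Rightarrow> 'a) \<Rightarrow> nat graph" where
  "pair_graph R n lam eta =
     ({1..n}, {{i, j} |i j. i \<in> {1..n} \<and> j \<in> {1..n} \<and> i \<noteq> j \<and> minor2 R lam eta i j = \<zero>\<^bsub>R\<^esub>})"


section \<open>Adequacy of the definitions\<close>

text \<open>\<^const>\<open>genideal\<close> collapses to the whole type when its first argument is not a ring, so it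
  matters that the coordinate description of the exterior algebra really is one. The lemmas below
  establish this, the defining relations of the generators, that ordered products of generators
  are the basis monomials, and that scalar multiplication on cosets acts on representatives.\<close>

lemma (in abelian_monoid) finsum_Sigma:
  assumes "finite A" "\<And>x. x \<in> A \<Longrightarrow> finite (B x)"
    and "\<And>x y. x \<in> A \<Longrightarrow> y \<in> B x \<Longrightarrow> f x y \<in> carrier G"
  shows "(\<Oplus>x\<in>A. \<Oplus>y\<in>B x. f x y) = (\<Oplus>p\<in>Sigma A B. f (fst p) (snd p))"
proof -
  have S: "Sigma A B = (\<Union>x\<in>A. Pair x ` B x)" by auto
  have "(\<Oplus>p\<in>Sigma A B. f (fst p) (snd p)) = (\<Oplus>x\<in>A. \<Oplus>p\<in>Pair x ` B x. f (fst p) (snd p))"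
    unfolding S using assms
    by (intro add.finprod_UN_disjoint) (auto simp: pairwise_def disjnt_def)
  also have "\<dots> = (\<Oplus>x\<in>A. \<Oplus>y\<in>B x. f x y)"
  proof (rule finsum_cong')
    fix x assume x: "x \<in> A"
    have "(\<Oplus>p\<in>Pair x ` B x. f (fst p) (snd p)) = (\<Oplus>y\<in>B x. f (fst (x, y)) (snd (x, y)))"
      by (rule finsum_reindex) (use assms x in \<open>auto simp: inj_on_def\<close>)
    then show "(\<Oplus>p\<in>Pair x ` B x. f (fst p) (snd p)) = (\<Oplus>y\<in>B x. f x y)" by simp
  qed (use assms in \<open>auto intro!: finsum_closed\<close>)
  finally show ?thesis by simp
qed

context cring
begin

lemma shuffle_sign_closed [simp]: "shuffle_sign R S T \<in> carrier R"
  by (simp add: shuffle_sign_def)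

lemma shuffle_sign_empty [simp]: "shuffle_sign R {} T = \<one>" "shuffle_sign R S {} = \<one>"
  by (simp_all add: shuffle_sign_def)

lemma shuffle_sign_Un:
  assumes "finite S" "finite T" "finite V" "T \<inter> V = {}"
  shows "shuffle_sign R S (T \<union> V) = shuffle_sign R S T \<otimes> shuffle_sign R S V"
    and "shuffle_sign R (T \<union> V) S = shuffle_sign R T S \<otimes> shuffle_sign R V S"
proof -
  let ?inv = "\<lambda>S T. {(i, j). i \<in> S \<and> j \<in> T \<and> (j::nat) < i}"
  have fin: "finite (?inv A B)" if "finite A" "finite B" for A B
    by (rule finite_subset[OF _ finite_cartesian_product[OF that]]) auto
  have 1: "?inv S (T \<union> V) = ?inv S T \<union> ?inv S V" and 2: "?inv (T \<union> V) S = ?inv T S \<union> ?inv V S"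
    by auto
  have "card (?inv S (T \<union> V)) = card (?inv S T) + card (?inv S V)"
    unfolding 1 by (rule card_Un_disjoint) (use assms fin in auto)
  then show "shuffle_sign R S (T \<union> V) = shuffle_sign R S T \<otimes> shuffle_sign R S V"
    unfolding shuffle_sign_def by (simp add: nat_pow_mult)
  have "card (?inv (T \<union> V) S) = card (?inv T S) + card (?inv V S)"
    unfolding 2 by (rule card_Un_disjoint) (use assms fin in auto)
  then show "shuffle_sign R (T \<union> V) S = shuffle_sign R T S \<otimes> shuffle_sign R V S"
    unfolding shuffle_sign_def by (simp add: nat_pow_mult)
qed

lemma exterior_algebra_carrierD:
  "x \<in> carrier (exterior_algebra R n) \<Longrightarrow> U \<subseteq> {1..n} \<Longrightarrow> x U \<in> carrier R"
  by (auto simp: exterior_algebra_def)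

lemma exterior_algebra_mult_apply:
  "U \<subseteq> {1..n} \<Longrightarrow> (x \<otimes>\<^bsub>exterior_algebra R n\<^esub> y) U =
     (\<Oplus>S\<in>Pow U. shuffle_sign R S (U - S) \<otimes> (x S \<otimes> y (U - S)))"
  "\<not> U \<subseteq> {1..n} \<Longrightarrow> (x \<otimes>\<^bsub>exterior_algebra R n\<^esub> y) U = undefined"
  by (simp_all add: exterior_algebra_def)

lemma exterior_algebra_one_apply:
  "U \<subseteq> {1..n} \<Longrightarrow> \<one>\<^bsub>exterior_algebra R n\<^esub> U = (if U = {} then \<one> else \<zero>)"
  by (simp add: exterior_algebra_def)

lemma exterior_algebra_add_apply:
  "U \<subseteq> {1..n} \<Longrightarrow> (x \<oplus>\<^bsub>exterior_algebra R n\<^esub> y) U = x U \<oplus> y U"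
  "\<not> U \<subseteq> {1..n} \<Longrightarrow> (x \<oplus>\<^bsub>exterior_algebra R n\<^esub> y) U = undefined"
  by (simp_all add: exterior_algebra_def)

lemma exterior_algebra_carrier_iff:
  "x \<in> carrier (exterior_algebra R n) \<longleftrightarrow>
     (\<forall>U. if U \<subseteq> {1..n} then x U \<in> carrier R else x U = undefined)"
  by (auto simp: exterior_algebra_def PiE_def extensional_def Pi_def)

lemma exterior_algebra_mult_closed:
  assumes x: "x \<in> carrier (exterior_algebra R n)" and y: "y \<in> carrier (exterior_algebra R n)"
  shows "x \<otimes>\<^bsub>exterior_algebra R n\<^esub> y \<in> carrier (exterior_algebra R n)"
  unfolding exterior_algebra_carrier_iff
proof (intro allI)
  fix U :: "nat set"
  have "(\<Oplus>S\<in>Pow U. shuffle_sign R S (U - S) \<otimes> (x S \<otimes> y (U - S))) \<in> carrier R"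
    if "U \<subseteq> {1..n}"
  proof (rule finsum_closed, rule Pi_I)
    fix S assume "S \<in> Pow U"
    then have "S \<subseteq> {1..n}" "U - S \<subseteq> {1..n}" using that by auto
    then show "shuffle_sign R S (U - S) \<otimes> (x S \<otimes> y (U - S)) \<in> carrier R"
      by (simp add: x[THEN exterior_algebra_carrierD] y[THEN exterior_algebra_carrierD])
  qed
  then show "if U \<subseteq> {1..n} then (x \<otimes>\<^bsub>exterior_algebra R n\<^esub> y) U \<in> carrier R
      else (x \<otimes>\<^bsub>exterior_algebra R n\<^esub> y) U = undefined"
    by (simp add: exterior_algebra_mult_apply)
qed

lemma exterior_algebra_assoc:
  assumes x: "x \<in> carrier (exterior_algebra R n)" and y: "y \<in> carrier (exterior_algebra R n)"
    and z: "z \<in> carrier (exterior_algebra R n)"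
  shows "(x \<otimes>\<^bsub>exterior_algebra R n\<^esub> y) \<otimes>\<^bsub>exterior_algebra R n\<^esub> z =
         x \<otimes>\<^bsub>exterior_algebra R n\<^esub> (y \<otimes>\<^bsub>exterior_algebra R n\<^esub> z)"
proof (rule ext)
  fix U :: "nat set"
  let ?s = "shuffle_sign R"
  note cl = x[THEN exterior_algebra_carrierD] y[THEN exterior_algebra_carrierD]
    z[THEN exterior_algebra_carrierD]
  show "((x \<otimes>\<^bsub>exterior_algebra R n\<^esub> y) \<otimes>\<^bsub>exterior_algebra R n\<^esub> z) U =
         (x \<otimes>\<^bsub>exterior_algebra R n\<^esub> (y \<otimes>\<^bsub>exterior_algebra R n\<^esub> z)) U"
  proof (cases "U \<subseteq> {1..n}")
    case False
    then show ?thesis by (simp add: exterior_algebra_def)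
  next
    case U: True
    then have finU: "finite U" by (rule finite_subset) simp
    have fin: "finite S" if "S \<subseteq> U" for S using finU that by (rule rev_finite_subset)
    define f where "f S T = ?s S T \<otimes> ?s S (U - S - T) \<otimes> ?s T (U - S - T)
        \<otimes> (x S \<otimes> (y T \<otimes> z (U - S - T)))" for S T
    have fcl: "f S T \<in> carrier R" if "S \<subseteq> U" "T \<subseteq> U" for S T
    proof -
      have "S \<subseteq> {1..n}" "T \<subseteq> {1..n}" "U - S - T \<subseteq> {1..n}" using that U by blast+
      then show ?thesis by (simp add: f_def cl)
    qed
    have L: "((x \<otimes>\<^bsub>exterior_algebra R n\<^esub> y) \<otimes>\<^bsub>exterior_algebra R n\<^esub> z) U =
       (\<Oplus>W\<in>Pow U. \<Oplus>S\<in>Pow W. f S (W - S))"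
    proof -
      have "((x \<otimes>\<^bsub>exterior_algebra R n\<^esub> y) \<otimes>\<^bsub>exterior_algebra R n\<^esub> z) U =
        (\<Oplus>W\<in>Pow U. ?s W (U - W) \<otimes> ((\<Oplus>S\<in>Pow W. ?s S (W - S) \<otimes> (x S \<otimes> y (W - S))) \<otimes> z (U - W)))"
        unfolding exterior_algebra_mult_apply(1)[OF U]
      proof (rule finsum_cong')
        show "(\<lambda>W. ?s W (U - W) \<otimes>
            ((\<Oplus>S\<in>Pow W. ?s S (W - S) \<otimes> (x S \<otimes> y (W - S))) \<otimes> z (U - W))) \<in> Pow U \<rightarrow> carrier R"
        proof (rule Pi_I)
          fix W assume "W \<in> Pow U"
          then have W: "W \<subseteq> {1..n}" "U - W \<subseteq> {1..n}" using U by auto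
          show "?s W (U - W) \<otimes>
            ((\<Oplus>S\<in>Pow W. ?s S (W - S) \<otimes> (x S \<otimes> y (W - S))) \<otimes> z (U - W)) \<in> carrier R"
            using exterior_algebra_carrierD[OF exterior_algebra_mult_closed[OF x y] W(1)]
            by (simp add: exterior_algebra_mult_apply(1)[OF W(1)] cl(3)[OF W(2)])
        qed
      next
        fix W assume "W \<in> Pow U"
        then have W: "W \<subseteq> {1..n}" using U by auto
        show "?s W (U - W) \<otimes> ((x \<otimes>\<^bsub>exterior_algebra R n\<^esub> y) W \<otimes> z (U - W)) = ?s W (U - W) \<otimes>
            ((\<Oplus>S\<in>Pow W. ?s S (W - S) \<otimes> (x S \<otimes> y (W - S))) \<otimes> z (U - W))"
          by (simp only: exterior_algebra_mult_apply(1)[OF W])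
      qed simp
      also have "\<dots> = (\<Oplus>W\<in>Pow U. \<Oplus>S\<in>Pow W. f S (W - S))"
      proof (rule finsum_cong'[OF refl])
        fix W assume "W \<in> Pow U"
        then have W: "W \<subseteq> U" "W \<subseteq> {1..n}" "U - W \<subseteq> {1..n}" using U by auto
        have finW: "finite (Pow W)" using fin[OF W(1)] by simp
        have sub: "S \<subseteq> {1..n}" "W - S \<subseteq> {1..n}" if "S \<in> Pow W" for S using that W by auto
        have c1: "x S \<in> carrier R" "y (W - S) \<in> carrier R" if "S \<in> Pow W" for S
          using cl(1)[OF sub(1)[OF that]] cl(2)[OF sub(2)[OF that]] by simp_all
        have c2: "z (U - W) \<in> carrier R" using W(3) by (rule cl(3))
        have "?s W (U - W) \<otimes> ((\<Oplus>S\<in>Pow W. ?s S (W - S) \<otimes> (x S \<otimes> y (W - S))) \<otimes> z (U - W))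
           = (\<Oplus>S\<in>Pow W. ?s W (U - W) \<otimes> (?s S (W - S) \<otimes> (x S \<otimes> y (W - S)) \<otimes> z (U - W)))"
          using finW c1 c2 by (simp add: finsum_ldistr finsum_rdistr Pi_def)
        also have "\<dots> = (\<Oplus>S\<in>Pow W. f S (W - S))"
        proof (rule finsum_cong'[OF refl])
          fix S assume S: "S \<in> Pow W"
          have e: "U - S - (W - S) = U - W" "S \<union> (W - S) = W" using S W by auto
          have sg: "?s W (U - W) = ?s S (U - W) \<otimes> ?s (W - S) (U - W)"
            using shuffle_sign_Un(2)[of "U - W" S "W - S"] e(2) S W fin by auto
          show "?s W (U - W) \<otimes> (?s S (W - S) \<otimes> (x S \<otimes> y (W - S)) \<otimes> z (U - W)) = f S (W - S)"
            unfolding f_def e sg using c1[OF S] c2 by (simp add: m_ac)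
        qed (use fcl W in \<open>auto intro!: fcl\<close>)
        finally show "?s W (U - W) \<otimes> ((\<Oplus>S\<in>Pow W. ?s S (W - S) \<otimes> (x S \<otimes> y (W - S))) \<otimes> z (U - W))
           = (\<Oplus>S\<in>Pow W. f S (W - S))" .
      qed (use fcl in \<open>auto intro!: finsum_closed fcl\<close>)
      finally show ?thesis .
    qed
    have Rr: "(x \<otimes>\<^bsub>exterior_algebra R n\<^esub> (y \<otimes>\<^bsub>exterior_algebra R n\<^esub> z)) U =
       (\<Oplus>S\<in>Pow U. \<Oplus>T\<in>Pow (U - S). f S T)"
    proof -
      have sub': "U - S \<subseteq> {1..n}" for S using U by auto
      have "(x \<otimes>\<^bsub>exterior_algebra R n\<^esub> (y \<otimes>\<^bsub>exterior_algebra R n\<^esub> z)) U =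
        (\<Oplus>S\<in>Pow U. ?s S (U - S) \<otimes> (x S \<otimes> (\<Oplus>T\<in>Pow (U - S). ?s T (U - S - T) \<otimes> (y T \<otimes> z (U - S - T)))))"
        unfolding exterior_algebra_mult_apply(1)[OF U]
        by (simp only: exterior_algebra_mult_apply(1)[OF sub'])
      also have "\<dots> = (\<Oplus>S\<in>Pow U. \<Oplus>T\<in>Pow (U - S). f S T)"
      proof (rule finsum_cong'[OF refl])
        fix S assume "S \<in> Pow U"
        then have S: "S \<subseteq> U" "S \<subseteq> {1..n}" using U by auto
        have finS: "finite (Pow (U - S))" using finU by simp
        have c1: "y T \<in> carrier R" "z (U - S - T) \<in> carrier R" if "T \<in> Pow (U - S)" for T
        proof -
          have "T \<subseteq> {1..n}" "U - S - T \<subseteq> {1..n}" using that U by auto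
          then show "y T \<in> carrier R" "z (U - S - T) \<in> carrier R" by (blast intro: cl)+
        qed
        have c2: "x S \<in> carrier R" using S(2) by (rule cl(1))
        have "?s S (U - S) \<otimes> (x S \<otimes> (\<Oplus>T\<in>Pow (U - S). ?s T (U - S - T) \<otimes> (y T \<otimes> z (U - S - T))))
           = (\<Oplus>T\<in>Pow (U - S). ?s S (U - S) \<otimes> (x S \<otimes> (?s T (U - S - T) \<otimes> (y T \<otimes> z (U - S - T)))))"
          using finS c1 c2 by (simp add: finsum_rdistr Pi_def)
        also have "\<dots> = (\<Oplus>T\<in>Pow (U - S). f S T)"
        proof (rule finsum_cong'[OF refl])
          fix T assume T: "T \<in> Pow (U - S)"
          have e: "T \<union> (U - S - T) = U - S" using T by auto
          have sg: "?s S (U - S) = ?s S T \<otimes> ?s S (U - S - T)"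
            using shuffle_sign_Un(1)[of S T "U - S - T"] e fin[of S] fin[of T] fin[of "U - S - T"] S T
            by (metis Diff_disjoint Diff_subset PowD order_trans)
          show "?s S (U - S) \<otimes> (x S \<otimes> (?s T (U - S - T) \<otimes> (y T \<otimes> z (U - S - T)))) = f S T"
            unfolding f_def sg using c1[OF T] c2 by (simp add: m_ac)
        qed (use fcl S in \<open>auto intro!: fcl\<close>)
        finally show "?s S (U - S) \<otimes> (x S \<otimes> (\<Oplus>T\<in>Pow (U - S). ?s T (U - S - T) \<otimes> (y T \<otimes> z (U - S - T))))
           = (\<Oplus>T\<in>Pow (U - S). f S T)" .
      qed (use fcl in \<open>auto intro!: finsum_closed fcl\<close>)
      finally show ?thesis .
    qed
    have "(\<Oplus>W\<in>Pow U. \<Oplus>S\<in>Pow W. f S (W - S)) =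
        (\<Oplus>p\<in>Sigma (Pow U) Pow. f (snd p) (fst p - snd p))"
      using fin finU by (intro finsum_Sigma) (auto intro!: fcl)
    also have "\<dots> = (\<Oplus>q\<in>(\<lambda>p. (snd p, fst p - snd p)) ` Sigma (Pow U) Pow. f (fst q) (snd q))"
      by (subst finsum_reindex) (auto simp: inj_on_def intro!: fcl)
    also have "(\<lambda>p. (snd p, fst p - snd p)) ` Sigma (Pow U) Pow = Sigma (Pow U) (\<lambda>S. Pow (U - S))"
    proof
      show "Sigma (Pow U) (\<lambda>S. Pow (U - S)) \<subseteq> (\<lambda>p. (snd p, fst p - snd p)) ` Sigma (Pow U) Pow"
      proof
        fix q assume q: "q \<in> Sigma (Pow U) (\<lambda>S. Pow (U - S))"
        show "q \<in> (\<lambda>p. (snd p, fst p - snd p)) ` Sigma (Pow U) Pow"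
          by (rule image_eqI[of _ _ "(fst q \<union> snd q, fst q)"]) (use q in auto)
      qed
    qed auto
    also have "(\<Oplus>q\<in>Sigma (Pow U) (\<lambda>S. Pow (U - S)). f (fst q) (snd q)) =
        (\<Oplus>S\<in>Pow U. \<Oplus>T\<in>Pow (U - S). f S T)"
      using finU by (intro finsum_Sigma[symmetric]) (auto intro!: fcl)
    finally show ?thesis using L Rr by simp
  qed
qed

lemma exterior_algebra_one_mult:
  assumes x: "x \<in> carrier (exterior_algebra R n)"
  shows "\<one>\<^bsub>exterior_algebra R n\<^esub> \<otimes>\<^bsub>exterior_algebra R n\<^esub> x = x"
    and "x \<otimes>\<^bsub>exterior_algebra R n\<^esub> \<one>\<^bsub>exterior_algebra R n\<^esub> = x"
proof -
  note cl = x[THEN exterior_algebra_carrierD]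
  have und: "x U = undefined" if "\<not> U \<subseteq> {1..n}" for U
    using x that by (auto simp: exterior_algebra_def PiE_def extensional_def)
  show "\<one>\<^bsub>exterior_algebra R n\<^esub> \<otimes>\<^bsub>exterior_algebra R n\<^esub> x = x"
  proof (rule ext)
    fix U
    show "(\<one>\<^bsub>exterior_algebra R n\<^esub> \<otimes>\<^bsub>exterior_algebra R n\<^esub> x) U = x U"
    proof (cases "U \<subseteq> {1..n}")
      case U: True
      then have finU: "finite U" by (rule finite_subset) simp
      have "(\<one>\<^bsub>exterior_algebra R n\<^esub> \<otimes>\<^bsub>exterior_algebra R n\<^esub> x) U =
        (\<Oplus>S\<in>Pow U. if {} = S then x U else \<zero>)"
      proof -
        have c: "x (U - S) \<in> carrier R" "U - S \<subseteq> {1..n}" for S using U by (auto intro!: cl)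
        have c': "S \<subseteq> {1..n}" if "S \<in> Pow U" for S using that U by auto
        show ?thesis unfolding exterior_algebra_mult_apply(1)[OF U]
        proof (rule finsum_cong')
          fix S assume "S \<in> Pow U"
          from c'[OF this] show "shuffle_sign R S (U - S) \<otimes> (\<one>\<^bsub>exterior_algebra R n\<^esub> S \<otimes> x (U - S)) =
            (if {} = S then x U else \<zero>)"
            using c[of S] by (auto simp: exterior_algebra_one_apply)
        qed (use c[of "{}"] in auto)
      qed
      also have "\<dots> = x U" using finU U cl by (subst finsum_singleton) auto
      finally show ?thesis .
    qed (simp add: exterior_algebra_mult_apply und)
  qed
  show "x \<otimes>\<^bsub>exterior_algebra R n\<^esub> \<one>\<^bsub>exterior_algebra R n\<^esub> = x"
  proof (rule ext)
    fix U
    show "(x \<otimes>\<^bsub>exterior_algebra R n\<^esub> \<one>\<^bsub>exterior_algebra R n\<^esub>) U = x U"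
    proof (cases "U \<subseteq> {1..n}")
      case U: True
      then have finU: "finite U" by (rule finite_subset) simp
      have "(x \<otimes>\<^bsub>exterior_algebra R n\<^esub> \<one>\<^bsub>exterior_algebra R n\<^esub>) U =
        (\<Oplus>S\<in>Pow U. if U = S then x U else \<zero>)"
      proof -
        have c: "x S \<in> carrier R" "U - S \<subseteq> {1..n}" "U - S = {} \<longleftrightarrow> U = S" if "S \<in> Pow U" for S
          using U that by (auto intro!: cl)
        show ?thesis unfolding exterior_algebra_mult_apply(1)[OF U]
        proof (rule finsum_cong')
          fix S assume S: "S \<in> Pow U"
          show "shuffle_sign R S (U - S) \<otimes> (x S \<otimes> \<one>\<^bsub>exterior_algebra R n\<^esub> (U - S)) =
            (if U = S then x U else \<zero>)"
            unfolding exterior_algebra_one_apply[OF c(2)[OF S]] c(3)[OF S] using c(1)[OF S] by auto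
        qed (use c(1)[of U] in auto)
      qed
      also have "\<dots> = x U" using finU U cl by (subst finsum_singleton) auto
      finally show ?thesis .
    qed (simp add: exterior_algebra_mult_apply und)
  qed
qed

lemma exterior_algebra_distr:
  assumes x: "x \<in> carrier (exterior_algebra R n)" and y: "y \<in> carrier (exterior_algebra R n)"
    and z: "z \<in> carrier (exterior_algebra R n)"
  shows "(x \<oplus>\<^bsub>exterior_algebra R n\<^esub> y) \<otimes>\<^bsub>exterior_algebra R n\<^esub> z =
     x \<otimes>\<^bsub>exterior_algebra R n\<^esub> z \<oplus>\<^bsub>exterior_algebra R n\<^esub> y \<otimes>\<^bsub>exterior_algebra R n\<^esub> z"
    and "z \<otimes>\<^bsub>exterior_algebra R n\<^esub> (x \<oplus>\<^bsub>exterior_algebra R n\<^esub> y) =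
     z \<otimes>\<^bsub>exterior_algebra R n\<^esub> x \<oplus>\<^bsub>exterior_algebra R n\<^esub> z \<otimes>\<^bsub>exterior_algebra R n\<^esub> y"
proof -
  note cl = x[THEN exterior_algebra_carrierD] y[THEN exterior_algebra_carrierD]
    z[THEN exterior_algebra_carrierD]
  have c: "x S \<in> carrier R" "y S \<in> carrier R" "z S \<in> carrier R"
    "x (U - S) \<in> carrier R" "y (U - S) \<in> carrier R" "z (U - S) \<in> carrier R"
    "S \<subseteq> {1..n}" "U - S \<subseteq> {1..n}"
    if "U \<subseteq> {1..n}" "S \<subseteq> U" for S U using that by (auto intro!: cl)
  show "(x \<oplus>\<^bsub>exterior_algebra R n\<^esub> y) \<otimes>\<^bsub>exterior_algebra R n\<^esub> z = x \<otimes>\<^bsub>exterior_algebra R n\<^esub> z \<oplus>\<^bsub>exterior_algebra R n\<^esub> y \<otimes>\<^bsub>exterior_algebra R n\<^esub> z"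
  proof (rule ext)
    fix U
    show "((x \<oplus>\<^bsub>exterior_algebra R n\<^esub> y) \<otimes>\<^bsub>exterior_algebra R n\<^esub> z) U = (x \<otimes>\<^bsub>exterior_algebra R n\<^esub> z \<oplus>\<^bsub>exterior_algebra R n\<^esub> y \<otimes>\<^bsub>exterior_algebra R n\<^esub> z) U"
    proof (cases "U \<subseteq> {1..n}")
      case True
      note c = c[OF True]
      have "(\<Oplus>S\<in>Pow U. shuffle_sign R S (U - S) \<otimes> ((x \<oplus>\<^bsub>exterior_algebra R n\<^esub> y) S \<otimes> z (U - S))) =
        (\<Oplus>S\<in>Pow U. shuffle_sign R S (U - S) \<otimes> (x S \<otimes> z (U - S)) \<oplus>
            shuffle_sign R S (U - S) \<otimes> (y S \<otimes> z (U - S)))"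
        by (rule finsum_cong')
           (auto simp: c exterior_algebra_add_apply(1)[OF c(7)] exterior_algebra_add_apply(1)[OF c(8)] l_distr r_distr)
      also have "\<dots> = (\<Oplus>S\<in>Pow U. shuffle_sign R S (U - S) \<otimes> (x S \<otimes> z (U - S))) \<oplus>
          (\<Oplus>S\<in>Pow U. shuffle_sign R S (U - S) \<otimes> (y S \<otimes> z (U - S)))"
        by (rule finsum_addf) (auto simp: c)
      finally show ?thesis
        by (simp only: exterior_algebra_mult_apply(1)[OF True] exterior_algebra_add_apply(1)[OF True])
    qed (simp add: exterior_algebra_add_apply exterior_algebra_mult_apply)
  qed
  show "z \<otimes>\<^bsub>exterior_algebra R n\<^esub> (x \<oplus>\<^bsub>exterior_algebra R n\<^esub> y) = z \<otimes>\<^bsub>exterior_algebra R n\<^esub> x \<oplus>\<^bsub>exterior_algebra R n\<^esub> z \<otimes>\<^bsub>exterior_algebra R n\<^esub> y"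
  proof (rule ext)
    fix U
    show "(z \<otimes>\<^bsub>exterior_algebra R n\<^esub> (x \<oplus>\<^bsub>exterior_algebra R n\<^esub> y)) U = (z \<otimes>\<^bsub>exterior_algebra R n\<^esub> x \<oplus>\<^bsub>exterior_algebra R n\<^esub> z \<otimes>\<^bsub>exterior_algebra R n\<^esub> y) U"
    proof (cases "U \<subseteq> {1..n}")
      case True
      note c = c[OF True]
      have "(\<Oplus>S\<in>Pow U. shuffle_sign R S (U - S) \<otimes> (z S \<otimes> (x \<oplus>\<^bsub>exterior_algebra R n\<^esub> y) (U - S))) =
        (\<Oplus>S\<in>Pow U. shuffle_sign R S (U - S) \<otimes> (z S \<otimes> x (U - S)) \<oplus>
            shuffle_sign R S (U - S) \<otimes> (z S \<otimes> y (U - S)))"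
        by (rule finsum_cong')
           (auto simp: c exterior_algebra_add_apply(1)[OF c(7)] exterior_algebra_add_apply(1)[OF c(8)] l_distr r_distr)
      also have "\<dots> = (\<Oplus>S\<in>Pow U. shuffle_sign R S (U - S) \<otimes> (z S \<otimes> x (U - S))) \<oplus>
          (\<Oplus>S\<in>Pow U. shuffle_sign R S (U - S) \<otimes> (z S \<otimes> y (U - S)))"
        by (rule finsum_addf) (auto simp: c)
      finally show ?thesis
        by (simp only: exterior_algebra_mult_apply(1)[OF True] exterior_algebra_add_apply(1)[OF True])
    qed (simp add: exterior_algebra_add_apply exterior_algebra_mult_apply)
  qed
qed

lemma exterior_algebra_abelian_group: "abelian_group (exterior_algebra R n)"
proof (rule abelian_groupI)
  fix x assume x: "x \<in> carrier (exterior_algebra R n)"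
  note cl = x[THEN exterior_algebra_carrierD]
  show "\<exists>y\<in>carrier (exterior_algebra R n). y \<oplus>\<^bsub>exterior_algebra R n\<^esub> x = \<zero>\<^bsub>exterior_algebra R n\<^esub>"
    by (rule bexI[of _ "\<lambda>U\<in>Pow {1..n}. \<ominus> x U"])
       (auto simp: exterior_algebra_def cl l_neg intro!: restrict_ext cl)
  show "\<zero>\<^bsub>exterior_algebra R n\<^esub> \<oplus>\<^bsub>exterior_algebra R n\<^esub> x = x"
    using x by (auto simp: exterior_algebra_def fun_eq_iff PiE_def extensional_def Pi_def)
qed (auto simp: exterior_algebra_def PiE_iff a_ac fun_eq_iff)

lemma exterior_algebra_ring: "ring (exterior_algebra R n)"
proof (rule ringI)
  show "monoid (exterior_algebra R n)"
  proof
    show "\<one>\<^bsub>exterior_algebra R n\<^esub> \<in> carrier (exterior_algebra R n)"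
      by (auto simp: exterior_algebra_def)
  qed (simp_all add: exterior_algebra_mult_closed exterior_algebra_assoc exterior_algebra_one_mult)
qed (simp_all add: exterior_algebra_abelian_group exterior_algebra_distr)

lemma ext_monom_mult:
  assumes S: "S \<subseteq> {1..n}" and T: "T \<subseteq> {1..n}"
  shows "ext_monom R n S \<otimes>\<^bsub>exterior_algebra R n\<^esub> ext_monom R n T =
    (\<lambda>U\<in>Pow {1..n}. if S \<inter> T = {} \<and> U = S \<union> T then shuffle_sign R S T else \<zero>)"
proof (rule ext)
  fix U
  show "(ext_monom R n S \<otimes>\<^bsub>exterior_algebra R n\<^esub> ext_monom R n T) U =
    (\<lambda>U\<in>Pow {1..n}. if S \<inter> T = {} \<and> U = S \<union> T then shuffle_sign R S T else \<zero>) U"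
  proof (cases "U \<subseteq> {1..n}")
    case U: True
    then have finU: "finite U" by (rule finite_subset) simp
    let ?c = "if S \<inter> T = {} \<and> U = S \<union> T then shuffle_sign R S T else \<zero>"
    have "(\<Oplus>A\<in>Pow U. shuffle_sign R A (U - A) \<otimes> (ext_monom R n S A \<otimes> ext_monom R n T (U - A))) =
        (\<Oplus>A\<in>Pow U. if S = A then ?c else \<zero>)"
    proof (rule finsum_cong')
      fix A assume "A \<in> Pow U"
      then have A: "A \<subseteq> U" "A \<subseteq> {1..n}" "U - A \<subseteq> {1..n}" using U by auto
      have eq: "U - S = T \<longleftrightarrow> S \<inter> T = {} \<and> U = S \<union> T" if "S = A" using that A by auto
      have "ext_monom R n S A = (if A = S then \<one> else \<zero>)"
        "ext_monom R n T (U - A) = (if U - A = T then \<one> else \<zero>)"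
        unfolding ext_monom_def using A(2,3) by (simp_all only: restrict_apply' Pow_iff)
      then show "shuffle_sign R A (U - A) \<otimes> (ext_monom R n S A \<otimes> ext_monom R n T (U - A)) =
          (if S = A then ?c else \<zero>)"
        using eq by auto
    qed auto
    also have "\<dots> = ?c"
    proof (cases "S \<subseteq> U")
      case True
      then show ?thesis using finU by (subst finsum_singleton) auto
    next
      case False
      then have "(\<Oplus>A\<in>Pow U. if S = A then ?c else \<zero>) = (\<Oplus>A\<in>Pow U. \<zero>)"
        by (intro finsum_cong') auto
      then show ?thesis using False by auto
    qed
    finally show ?thesis using U by (simp add: exterior_algebra_mult_apply)
  qed (simp add: exterior_algebra_mult_apply)
qed

lemma ext_gen_square:
  assumes "i \<in> {1..n}"
  shows "ext_gen R n i \<otimes>\<^bsub>exterior_algebra R n\<^esub> ext_gen R n i = \<zero>\<^bsub>exterior_algebra R n\<^esub>"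
  using assms by (simp add: ext_gen_def ext_monom_mult) (simp add: exterior_algebra_def)

lemma ext_gen_anticommute:
  assumes "i \<in> {1..n}" "j \<in> {1..n}"
  shows "ext_gen R n i \<otimes>\<^bsub>exterior_algebra R n\<^esub> ext_gen R n j
    \<oplus>\<^bsub>exterior_algebra R n\<^esub> ext_gen R n j \<otimes>\<^bsub>exterior_algebra R n\<^esub> ext_gen R n i
    = \<zero>\<^bsub>exterior_algebra R n\<^esub>"
proof -
  have "shuffle_sign R {i} {j} \<oplus> shuffle_sign R {j} {i} = \<zero>" if "i \<noteq> j"
  proof -
    have *: "{(a, b). a \<in> {k} \<and> b \<in> {l} \<and> b < a} = (if l < k then {(k, l)} else {})" for k l :: nat
      by auto
    show ?thesis using that unfolding shuffle_sign_def * by (auto simp: r_neg l_neg)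
  qed
  then show ?thesis using assms
    by (simp add: ext_gen_def ext_monom_mult) (auto simp: exterior_algebra_def fun_eq_iff)
qed

lemma ext_wedge_sorted:
  assumes "sorted_wrt (<) is" "set is \<subseteq> {1..n}"
  shows "ext_wedge R n is = ext_monom R n (set is)"
  using assms
proof (induction "is")
  case Nil
  then show ?case by (auto simp: ext_wedge_def exterior_algebra_def ext_monom_def)
next
  case (Cons i "is")
  have sg: "shuffle_sign R {i} (set is) = \<one>"
  proof -
    have *: "{(a, b). a \<in> {i} \<and> b \<in> set is \<and> b < a} = {}" using Cons.prems by fastforce
    show ?thesis unfolding shuffle_sign_def * by simp
  qed
  have "i \<notin> set is" using Cons.prems by auto
  moreover have "ext_wedge R n (i # is) = ext_monom R n {i} \<otimes>\<^bsub>exterior_algebra R n\<^esub> ext_monom R n (set is)"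
    using Cons by (simp add: ext_wedge_def ext_gen_def)
  ultimately show ?case using Cons.prems sg
    by (subst (asm) ext_monom_mult) (auto simp: ext_monom_def)
qed

lemma exterior_algebra_smult:
  assumes x: "x \<in> carrier (exterior_algebra R n)" and r: "r \<in> carrier R"
  shows "r \<odot>\<^bsub>exterior_algebra R n\<^esub> x =
    (r \<odot>\<^bsub>exterior_algebra R n\<^esub> \<one>\<^bsub>exterior_algebra R n\<^esub>) \<otimes>\<^bsub>exterior_algebra R n\<^esub> x"
    and "r \<odot>\<^bsub>exterior_algebra R n\<^esub> x \<in> carrier (exterior_algebra R n)"
proof -
  note cl = x[THEN exterior_algebra_carrierD]
  show "r \<odot>\<^bsub>exterior_algebra R n\<^esub> x \<in> carrier (exterior_algebra R n)"
    using x r by (auto simp: exterior_algebra_def)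
  show "r \<odot>\<^bsub>exterior_algebra R n\<^esub> x =
    (r \<odot>\<^bsub>exterior_algebra R n\<^esub> \<one>\<^bsub>exterior_algebra R n\<^esub>) \<otimes>\<^bsub>exterior_algebra R n\<^esub> x"
    (is "_ = ?r \<otimes>\<^bsub>_\<^esub> x")
  proof (rule ext)
    fix U
    show "(r \<odot>\<^bsub>exterior_algebra R n\<^esub> x) U = (?r \<otimes>\<^bsub>exterior_algebra R n\<^esub> x) U"
    proof (cases "U \<subseteq> {1..n}")
      case U: True
      then have finU: "finite U" by (rule finite_subset) simp
      have c: "x (U - S) \<in> carrier R" for S using U by (auto intro!: cl)
      have rS: "?r S = (if S = {} then r else \<zero>)" if "S \<in> Pow U" for S
      proof -
        have "S \<in> Pow {1..n}" using that U by auto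
        then show ?thesis using r by (simp add: exterior_algebra_def)
      qed
      have "(?r \<otimes>\<^bsub>exterior_algebra R n\<^esub> x) U = (\<Oplus>S\<in>Pow U. if {} = S then r \<otimes> x U else \<zero>)"
        unfolding exterior_algebra_mult_apply(1)[OF U]
        by (rule finsum_cong') (use rS r c c[of "{}"] in auto)
      also have "\<dots> = r \<otimes> x U" using finU r c[of "{}"] by (subst finsum_singleton) auto
      finally show ?thesis using U by (simp add: exterior_algebra_def)
    qed (simp add: exterior_algebra_def)
  qed
qed

lemma os_ideal_ideal:
  assumes "\<C> \<subseteq> Pow {1..n}"
  shows "ideal (os_ideal R n \<C>) (exterior_algebra R n)"
proof -
  interpret E: ring "exterior_algebra R n" by (rule exterior_algebra_ring)
  have gen: "ext_gen R n i \<in> carrier (exterior_algebra R n)" for i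
    by (auto simp: ext_gen_def ext_monom_def exterior_algebra_def)
  have wedge: "ext_wedge R n is \<in> carrier (exterior_algebra R n)" for "is"
    by (induction "is") (auto simp: ext_wedge_def gen)
  have "ext_boundary R n C \<in> carrier (exterior_algebra R n)" for C
    unfolding ext_boundary_def Let_def
    by (auto intro!: E.finsum_closed exterior_algebra_smult(2) wedge)
  then show ?thesis unfolding os_ideal_def by (intro E.genideal_ideal) auto
qed

lemma os_quotient_ring:
  assumes "\<C> \<subseteq> Pow {1..n}"
  shows "ring (exterior_algebra R n Quot os_ideal R n \<C>)"
  using os_ideal_ideal[OF assms] by (rule ideal.quotient_is_ring)

lemma os_algebra_smult_coset:
  assumes "\<C> \<subseteq> Pow {1..n}" and r: "r \<in> carrier R" and x: "x \<in> carrier (exterior_algebra R n)"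
  shows "r \<odot>\<^bsub>os_algebra R n \<C>\<^esub> (os_ideal R n \<C> +>\<^bsub>exterior_algebra R n\<^esub> x) =
    os_ideal R n \<C> +>\<^bsub>exterior_algebra R n\<^esub> (r \<odot>\<^bsub>exterior_algebra R n\<^esub> x)"
proof -
  let ?E = "exterior_algebra R n" and ?I = "os_ideal R n \<C>"
  let ?r = "r \<odot>\<^bsub>?E\<^esub> \<one>\<^bsub>?E\<^esub>"
  interpret I: ideal ?I ?E by (rule os_ideal_ideal[OF assms(1)])
  have rc: "?r \<in> carrier ?E" using r by (intro exterior_algebra_smult(2)) auto
  have "?I +>\<^bsub>?E\<^esub> (r \<odot>\<^bsub>?E\<^esub> y) = ?I +>\<^bsub>?E\<^esub> (r \<odot>\<^bsub>?E\<^esub> x)" if "y \<in> ?I +>\<^bsub>?E\<^esub> x" for y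
  proof -
    from that obtain h where h: "h \<in> ?I" "y = h \<oplus>\<^bsub>?E\<^esub> x" by (auto simp: a_r_coset_def r_coset_def)
    have hc: "h \<in> carrier ?E" using h(1) by (rule I.a_Hcarr)
    have "r \<odot>\<^bsub>?E\<^esub> y = ?r \<otimes>\<^bsub>?E\<^esub> h \<oplus>\<^bsub>?E\<^esub> r \<odot>\<^bsub>?E\<^esub> x"
      unfolding h(2) exterior_algebra_smult(1)[OF x r]
        exterior_algebra_smult(1)[OF I.add.m_closed[OF hc x] r]
      using hc x rc by (rule I.r_distr)
    moreover have "?r \<otimes>\<^bsub>?E\<^esub> h \<in> ?I" using h(1) rc by (rule I.I_l_closed)
    ultimately have "r \<odot>\<^bsub>?E\<^esub> y \<in> ?I +>\<^bsub>?E\<^esub> (r \<odot>\<^bsub>?E\<^esub> x)"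
      by (auto simp: a_r_coset_def r_coset_def)
    then show ?thesis
      using I.a_repr_independence[OF _ exterior_algebra_smult(2)[OF x r] I.a_subgroup] by simp
  qed
  moreover have "x \<in> ?I +>\<^bsub>?E\<^esub> x" using x by (rule I.a_rcos_self)
  ultimately have "(\<Union>y\<in>?I +>\<^bsub>?E\<^esub> x. ?I +>\<^bsub>?E\<^esub> (r \<odot>\<^bsub>?E\<^esub> y)) = ?I +>\<^bsub>?E\<^esub> (r \<odot>\<^bsub>?E\<^esub> x)"
    by (intro UN_constant_eq ballI)
  then show ?thesis by (simp add: os_algebra_def ring.defs)
qed

end

end

theory Submission
  imports Defs "HOL-Algebra.Multiplicative_Group"
begin

text \<open>Attach to each index \<open>i\<close> the vector (\<open>lam i\<close>,
  \<open>eta i\<close>). A vanishing minor says that two such vectors are linearly dependent over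
  the fraction field of \<open>R\<close>. Nonzero vectors are dependent exactly when they span the
  same line, so dependence is transitive through any nonzero vector; this is
  \<open>minor2_eq_zero_trans\<close>, and it gives (ii). A zero vector is dependent on every
  vector, so indices off the support are cone vertices. Conversely, if a support index were a cone
  vertex, all vectors would lie on its line and all minors would vanish, against
  non-parallelism.\<close>

lemma (in cring) minor2_eq_zero_iff:
  assumes "lam i \<in> carrier R" "lam j \<in> carrier R" "eta i \<in> carrier R" "eta j \<in> carrier R"
  shows "minor2 R lam eta i j = \<zero> \<longleftrightarrow> lam i \<otimes> eta j = lam j \<otimes> eta i"
  unfolding minor2_def using assms by (intro r_right_minus_eq) simp_all

text \<open>The fraction field is avoided: the desired equation is derived after multiplication by
  \<open>lam j\<close> and again after multiplication by \<open>eta j\<close>. One of these factors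
  is nonzero, and in a domain it cancels.\<close>

lemma (in domain) minor2_eq_zero_trans:
  assumes c: "lam i \<in> carrier R" "lam j \<in> carrier R" "lam k \<in> carrier R"
      "eta i \<in> carrier R" "eta j \<in> carrier R" "eta k \<in> carrier R"
    and nz: "lam j \<noteq> \<zero> \<or> eta j \<noteq> \<zero>"
    and "minor2 R lam eta i j = \<zero>" "minor2 R lam eta j k = \<zero>"
  shows "minor2 R lam eta i k = \<zero>"
proof -
  have ij: "lam i \<otimes> eta j = lam j \<otimes> eta i" and jk: "lam j \<otimes> eta k = lam k \<otimes> eta j"
    using assms by (simp_all add: minor2_eq_zero_iff)
  have "lam j \<otimes> (lam i \<otimes> eta k) = lam i \<otimes> (lam j \<otimes> eta k)"
    using c by (simp add: m_lcomm)
  also have "\<dots> = lam k \<otimes> (lam i \<otimes> eta j)"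
    unfolding jk using c by (simp add: m_lcomm)
  also have "\<dots> = lam j \<otimes> (lam k \<otimes> eta i)"
    unfolding ij using c by (simp add: m_lcomm)
  finally have 1: "lam j \<otimes> (lam i \<otimes> eta k) = lam j \<otimes> (lam k \<otimes> eta i)" .
  have "eta j \<otimes> (lam i \<otimes> eta k) = (lam i \<otimes> eta j) \<otimes> eta k"
    using c by (simp add: m_ac)
  also have "\<dots> = (lam j \<otimes> eta k) \<otimes> eta i"
    unfolding ij using c by (simp add: m_ac)
  also have "\<dots> = eta j \<otimes> (lam k \<otimes> eta i)"
    unfolding jk using c by (simp add: m_ac)
  finally have 2: "eta j \<otimes> (lam i \<otimes> eta k) = eta j \<otimes> (lam k \<otimes> eta i)" .
  have "lam i \<otimes> eta k = lam k \<otimes> eta i"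
    using nz 1 2 c by (auto simp: m_lcancel)
  then show ?thesis using c by (simp add: minor2_eq_zero_iff)
qed

lemma (in cring) minor2_commute_eq_zero:
  assumes "lam i \<in> carrier R" "lam j \<in> carrier R" "eta i \<in> carrier R" "eta j \<in> carrier R"
  shows "minor2 R lam eta i j = \<zero> \<longleftrightarrow> minor2 R lam eta j i = \<zero>"
  using assms by (auto simp: minor2_eq_zero_iff)

text \<open>An edge is an unordered pair, so its membership may be witnessed by either ordering of
  the indices; the symmetry of vanishing minors makes the two agree.\<close>

lemma (in cring) pair_graph_edge_iff:
  assumes "lam \<in> {1..n} \<rightarrow> carrier R" "eta \<in> {1..n} \<rightarrow> carrier R"
    and "i \<in> {1..n}" "j \<in> {1..n}"
  shows "{i, j} \<in> snd (pair_graph R n lam eta) \<longleftrightarrow> i \<noteq> j \<and> minor2 R lam eta i j = \<zero>"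
proof -
  have "minor2 R lam eta i j = \<zero> \<longleftrightarrow> minor2 R lam eta j i = \<zero>"
    using assms by (intro minor2_commute_eq_zero) auto
  then show ?thesis using assms(3,4) by (auto simp: pair_graph_def doubleton_eq_iff)
qed

theorem theorem3p9:
  fixes R :: "('a, 'm) ring_scheme"
    and n :: nat
    and H :: "nat \<Rightarrow> (complex ^ 'l) set"
    and lam eta :: "nat \<Rightarrow> 'a"
  assumes "domain R"
    and "hyperplane_arrangement n H"
    and "resonant_pair R n (circuits n H) lam eta"
  shows "pair_support R n lam eta =
           {v \<in> {1..n}. \<not> cone_vertex (pair_graph R n lam eta) v}
       \<and> (\<forall>i \<in> pair_support R n lam eta. \<forall>j \<in> pair_support R n lam eta.
           \<forall>k \<in> pair_support R n lam eta.
             {i, j} \<in> snd (pair_graph R n lam eta) \<longrightarrow>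
             {j, k} \<in> snd (pair_graph R n lam eta) \<longrightarrow> i \<noteq> k \<longrightarrow>
             {i, k} \<in> snd (pair_graph R n lam eta))"
proof -
  interpret domain R by (rule assms(1))
  have lam: "lam \<in> {1..n} \<rightarrow> carrier R" and eta: "eta \<in> {1..n} \<rightarrow> carrier R"
    and np: "\<not> parallel R n lam eta"
    using assms(3) by (auto simp: resonant_pair_def)
  have c: "lam i \<in> carrier R" "eta i \<in> carrier R" if "i \<in> {1..n}" for i
    using lam eta that by auto
  note edge = pair_graph_edge_iff[OF lam eta]
  let ?S = "pair_support R n lam eta"
  have S: "i \<in> ?S \<longleftrightarrow> i \<in> {1..n} \<and> (lam i \<noteq> \<zero>\<^bsub>R\<^esub> \<or> eta i \<noteq> \<zero>\<^bsub>R\<^esub>)" for i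
    by (simp add: pair_support_def)
  \<comment> \<open>Only the middle index has to lie in the support. The freedom in \<open>i\<close>
    and \<open>k\<close> is what the cone vertex argument needs.\<close>
  have trans: "minor2 R lam eta i k = \<zero>\<^bsub>R\<^esub>"
    if "j \<in> ?S" "i \<in> {1..n}" "k \<in> {1..n}"
      "minor2 R lam eta i j = \<zero>\<^bsub>R\<^esub>" "minor2 R lam eta j k = \<zero>\<^bsub>R\<^esub>" for i j k
    using that c S by (intro minor2_eq_zero_trans[of lam i j k eta]) blast+
  have refl: "minor2 R lam eta i i = \<zero>\<^bsub>R\<^esub>" if "i \<in> {1..n}" for i
    using c[OF that] by (simp add: minor2_eq_zero_iff)
  have cone: "cone_vertex (pair_graph R n lam eta) v \<longleftrightarrow>
      (\<forall>w\<in>{1..n}. minor2 R lam eta v w = \<zero>\<^bsub>R\<^esub>)" if v: "v \<in> {1..n}" for v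
  proof -
    have "fst (pair_graph R n lam eta) = {1..n}" by (simp add: pair_graph_def)
    then show ?thesis unfolding cone_vertex_def using v edge[OF v] refl[OF v] by metis
  qed
  have "v \<in> ?S \<longleftrightarrow> \<not> cone_vertex (pair_graph R n lam eta) v" if v: "v \<in> {1..n}" for v
  proof
    assume vS: "v \<in> ?S"
    show "\<not> cone_vertex (pair_graph R n lam eta) v"
    proof
      assume "cone_vertex (pair_graph R n lam eta) v"
      then have 1: "minor2 R lam eta v w = \<zero>\<^bsub>R\<^esub>" if "w \<in> {1..n}" for w
        using cone[OF v] that by blast
      have 2: "minor2 R lam eta w v = \<zero>\<^bsub>R\<^esub>" if "w \<in> {1..n}" for w
        using 1[OF that] minor2_commute_eq_zero[of lam v w eta] c v that by blast
      \<comment> \<open>Any two indices are linked through \<open>v\<close>, whose vector is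
        nonzero.\<close>
      have "parallel R n lam eta"
        unfolding parallel_def using trans[OF vS] 1 2 by blast
      with np show False ..
    qed
  next
    assume nc: "\<not> cone_vertex (pair_graph R n lam eta) v"
    show "v \<in> ?S"
    proof (rule ccontr)
      assume "v \<notin> ?S"
      \<comment> \<open>The zero vector has zero minor with every other one, which makes
        \<open>v\<close> a cone vertex.\<close>
      then have "lam v = \<zero>\<^bsub>R\<^esub>" "eta v = \<zero>\<^bsub>R\<^esub>" using v S by auto
      then have "minor2 R lam eta v w = \<zero>\<^bsub>R\<^esub>" if "w \<in> {1..n}" for w
        using c[OF that] by (simp add: minor2_eq_zero_iff)
      then show False using nc cone[OF v] by blast
    qed
  qed
  then have "?S = {v \<in> {1..n}. \<not> cone_vertex (pair_graph R n lam eta) v}"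
    using S by blast
  \<comment> \<open>Here \<open>j\<close> is the middle index. The condition
    \<open>i \<noteq> k\<close> is needed because the graph has no loops.\<close>
  moreover have "{i, k} \<in> snd (pair_graph R n lam eta)"
    if "i \<in> ?S" "j \<in> ?S" "k \<in> ?S" "{i, j} \<in> snd (pair_graph R n lam eta)"
      "{j, k} \<in> snd (pair_graph R n lam eta)" "i \<noteq> k" for i j k
    using that trans[of j i k] edge S by blast
  ultimately show ?thesis by blast
qed

end
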